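(* Let $f:\mathbb{R}^d\to\mathbb{R}$ be differentiable and $(L_0,L_1)$-smooth with respect to a positive semi-definite matrix $\bm{H}\in\mathbb{R}^{d\times d}$, and let $\bm{S}_t\in\mathbb{R}^{d\times\ell}$, with columns $\bm{s}_1,\dots,\bm{s}_\ell$, be an oblivious $(\frac14,k,\delta)$-random sketching matrix with $k\ge4$ and $0<\delta<1$. Assume that the smoothing parameter $\alpha>0$ of the deterministic adaptive zeroth-order method satisfies $$\alpha^2\le\min\left\{\frac{1}{2L_1^2\zeta_1},\ \frac{3\|\nabla f(\bm{x}_t)\|^2}{8L_0^2\zeta_1}\right\},\qquad\zeta_1=\|\bm{H}\|^2\left(\frac{5\ell}{4}+\frac{d\ell}{4k}\right)^2.$$ Conditioned on the event $\mathcal{E}_{t,2}$ (defined in the context), it holds that $$\sigma_t\le\frac{13\,\alpha\,\|\nabla f(\bm{x}_t)\|}{2\sqrt{\ell-1}}.$$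
   Context: $\|\cdot\|$ is the Euclidean norm of vectors and the spectral norm of matrices, $\|\cdot\|_F$ the Frobenius norm; $\|\bm{x}\|_{\bm{H}}=\sqrt{\bm{x}^\top\bm{H}\bm{x}}$. $(L_0,L_1)$-smoothness w.r.t. $\bm{H}$: for all $\bm{x},\bm{y}\in\mathbb{R}^d$ with $\|\bm{y}-\bm{x}\|_{\bm{H}}\le 1/(L_1\sqrt{\|\bm{H}\|})$, $\big|f(\bm{y})-f(\bm{x})-\langle\nabla f(\bm{x}),\bm{y}-\bm{x}\rangle\big|\le\frac{L_0+L_1\|\nabla f(\bm{x})\|}{2}\|\bm{y}-\bm{x}\|_{\bm{H}}^2$. Oblivious $(\gamma,k,\delta)$-random sketching matrix: given a matrix $\bm{A}\in\mathbb{R}^{d\times d}$, a random $\bm{S}\in\mathbb{R}^{d\times\ell}$ independent of $\bm{A}$ such that, with probability at least $1-\delta$, $\|\bm{A}^\top\bm{S}\bm{S}^\top\bm{A}-\bm{A}^\top\bm{A}\|\le\gamma(\|\bm{A}\|^2+\|\bm{A}\|_F^2/k)$. Deterministic adaptive zeroth-order method: at iterate $\bm{x}_t$, with $\mathbf{g}(\bm{x}_t)=\sum_{i=1}^\ell\frac{f(\bm{x}_t+\alpha\bm{s}_i)-f(\bm{x}_t)}{\alpha}\bm{s}_i$ and $\sigma_t=\sqrt{\frac{1}{\ell-1}\sum_{j=1}^\ell\big(f(\bm{x}_t+\alpha\bm{s}_j)-\frac1\ell\sum_{i=1}^\ell f(\bm{x}_t+\alpha\bm{s}_i)\big)^2}$,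 update $\bm{x}_{t+1}=\bm{x}_t-\eta\,\mathbf{g}(\bm{x}_t)/\sigma_t$ with step size $\eta>0$. Event $\mathcal{E}_{t,2}$: $(\frac34-\frac1k)\|\nabla f(\bm{x}_t)\|^2\le\nabla f(\bm{x}_t)^\top\bm{S}_t\bm{S}_t^\top\nabla f(\bm{x}_t)\le(\frac54+\frac1k)\|\nabla f(\bm{x}_t)\|^2$.
   Formalization: The bound fails on part of the event E_{t,2} when the sketch guarantee fails; it is proved on E_{t,2} for every outcome where the sketching inequality holds at A = I, and so "E_{t,2} implies the bound" has probability at least 1 − δ. L_0, L_1 ≥ 0 is assumed; zero denominators mean no restriction. *)

theory Defs
  imports "HOL-Probability.Probability"
begin

definition spec_norm :: "real^'n^'m \<Rightarrow> real" where
  "spec_norm A = onorm (\<lambda>v. A *v v)"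

definition frob_norm :: "real^'n^'m \<Rightarrow> real" where
  "frob_norm A = sqrt (\<Sum>i\<in>UNIV. \<Sum>j\<in>UNIV. (A $ i $ j)\<^sup>2)"

definition psd :: "real^'d^'d \<Rightarrow> bool" where
  "psd H \<longleftrightarrow> transpose H = H \<and> (\<forall>v. 0 \<le> v \<bullet> (H *v v))"

definition mat_norm :: "real^'d^'d \<Rightarrow> real^'d \<Rightarrow> real" where
  "mat_norm H v = sqrt (v \<bullet> (H *v v))"

text \<open>The gradient; meaningful only at points where \<open>f\<close> is differentiable.\<close>

definition grad :: "(real^'d \<Rightarrow> real) \<Rightarrow> real^'d \<Rightarrow> real^'d" where
  "grad f x = (THE D. GDERIV f x :> D)"

text \<open>
  The radius condition is \<open>\<parallel>y - x\<parallel>\<^sub>H \<le> 1 / (L1 * sqrt \<parallel>H\<parallel>)\<close>. It is stated without the division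
  so that the radius is infinite when \<open>L1 = 0\<close>; with the HOL convention \<open>1 / 0 = 0\<close> the
  condition would degenerate there.
\<close>

definition L0L1_smooth ::
    "(real^'d \<Rightarrow> real) \<Rightarrow> real^'d^'d \<Rightarrow> real \<Rightarrow> real \<Rightarrow> bool" where
  "L0L1_smooth f H L0 L1 \<longleftrightarrow>
     (\<forall>x y. L1 * sqrt (spec_norm H) * mat_norm H (y - x) \<le> 1 \<longrightarrow>
        \<bar>f y - f x - grad f x \<bullet> (y - x)\<bar>
          \<le> (L0 + L1 * norm (grad f x)) / 2 * (mat_norm H (y - x))\<^sup>2)"

definition sketch_ineq ::
    "real \<Rightarrow> real \<Rightarrow> real^'d^'d \<Rightarrow> real^'l^'d \<Rightarrow> bool" where
  "sketch_ineq \<gamma> k A S \<longleftrightarrow>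
     spec_norm (transpose A ** S ** transpose S ** A - transpose A ** A)
       \<le> \<gamma> * ((spec_norm A)\<^sup>2 + (frob_norm A)\<^sup>2 / k)"

text \<open>
  Obliviousness: the law of \<open>S\<close> is fixed before \<open>A\<close>, and the guarantee holds for every \<open>A\<close>.
\<close>

definition oblivious_sketch ::
    "'w measure \<Rightarrow> real \<Rightarrow> real \<Rightarrow> real \<Rightarrow> ('w \<Rightarrow> real^'l^'d) \<Rightarrow> bool" where
  "oblivious_sketch M \<gamma> k \<delta> S \<longleftrightarrow>
     S \<in> borel_measurable M \<and>
     (\<forall>A. measure M {\<omega> \<in> space M. sketch_ineq \<gamma> k A (S \<omega>)} \<ge> 1 - \<delta>)"

definition sigma_std ::
    "(real^'d \<Rightarrow> real) \<Rightarrow> real \<Rightarrow> real^'d \<Rightarrow> real^'l^'d \<Rightarrow> real" where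
  "sigma_std f \<alpha> x S =
     sqrt (1 / (real CARD('l) - 1) *
       (\<Sum>j\<in>UNIV. (f (x + \<alpha> *\<^sub>R column j S)
          - 1 / real CARD('l) * (\<Sum>i\<in>UNIV. f (x + \<alpha> *\<^sub>R column i S)))\<^sup>2))"

definition event2 ::
    "(real^'d \<Rightarrow> real) \<Rightarrow> real \<Rightarrow> real^'d \<Rightarrow> real^'l^'d \<Rightarrow> bool" where
  "event2 f k x S \<longleftrightarrow>
     (3/4 - 1/k) * (norm (grad f x))\<^sup>2 \<le> grad f x \<bullet> ((S ** transpose S) *v grad f x) \<and>
     grad f x \<bullet> ((S ** transpose S) *v grad f x) \<le> (5/4 + 1/k) * (norm (grad f x))\<^sup>2"

definition zeta1 :: "real^'d^'d \<Rightarrow> nat \<Rightarrow> real \<Rightarrow> real" where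
  "zeta1 H l k =
     (spec_norm H)\<^sup>2 * (5 * real l / 4 + real CARD('d) * real l / (4 * k))\<^sup>2"

text \<open>
  \<open>\<alpha>\<^sup>2 \<le> min (1 / (2 * L1\<^sup>2 * \<zeta>)) (3 * \<parallel>grad f x\<parallel>\<^sup>2 / (8 * L0\<^sup>2 * \<zeta>))\<close>, with a bound whose
  denominator vanishes read as infinite; hence the cross-multiplied form.
\<close>

definition smoothing_ok ::
    "(real^'d \<Rightarrow> real) \<Rightarrow> real \<Rightarrow> real \<Rightarrow> real \<Rightarrow> real \<Rightarrow> real^'d \<Rightarrow> bool" where
  "smoothing_ok f L0 L1 \<zeta> \<alpha> x \<longleftrightarrow>
     \<alpha>\<^sup>2 * (2 * L1\<^sup>2 * \<zeta>) \<le> 1 \<and>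
     \<alpha>\<^sup>2 * (8 * L0\<^sup>2 * \<zeta>) \<le> 3 * (norm (grad f x))\<^sup>2"

end

theory Submission
  imports Defs
begin

text \<open>
  Writing \<open>f (x + \<alpha> s\<^sub>j) - f x = \<alpha> \<langle>\<nabla>f x, s\<^sub>j\<rangle> + r\<^sub>j\<close>, the event bounds
  \<open>\<Sum>\<^sub>j \<langle>\<nabla>f x, s\<^sub>j\<rangle>\<^sup>2\<close> by \<open>3/2 \<parallel>\<nabla>f x\<parallel>\<^sup>2\<close>, while the sketch inequality for the identity matrix gives
  \<open>\<parallel>s\<^sub>j\<parallel>\<^sup>2 \<le> b := 5/4 + d/(4k)\<close>. Hence smoothness applies at \<open>x + \<alpha> s\<^sub>j\<close>, and the restriction on
  \<open>\<alpha>\<close> yields \<open>\<Sum>\<^sub>j r\<^sub>j\<^sup>2 \<le> 7/16 \<alpha>\<^sup>2 \<parallel>\<nabla>f x\<parallel>\<^sup>2\<close>. The sum of squared deviations from the mean is at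
  most the sum of squared deviations from \<open>f x\<close>, so it is bounded by
  \<open>(3 + 7/8) \<alpha>\<^sup>2 \<parallel>\<nabla>f x\<parallel>\<^sup>2\<close>.
\<close>

section \<open>Spectral norm bounds and the norms of the identity\<close>

lemma norm_matrix_vector_le_spec_norm: "norm (A *v v) \<le> spec_norm A * norm v"
  unfolding spec_norm_def by (rule onorm[OF matrix_vector_mul_bounded_linear])

lemma spec_norm_nonneg: "0 \<le> spec_norm A"
  unfolding spec_norm_def by (rule onorm_pos_le[OF matrix_vector_mul_bounded_linear])

lemma inner_matrix_vector_le_spec_norm: "v \<bullet> (A *v v) \<le> spec_norm A * (norm v)\<^sup>2"
proof -
  have "v \<bullet> (A *v v) \<le> norm v * norm (A *v v)" by (rule norm_cauchy_schwarz)
  also have "\<dots> \<le> norm v * (spec_norm A * norm v)"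
    by (intro mult_left_mono norm_matrix_vector_le_spec_norm) simp
  finally show ?thesis by (simp add: power2_eq_square mult_ac)
qed

lemma spec_norm_mat_1: "spec_norm (mat 1 :: real^'d^'d) = 1"
  by (simp add: spec_norm_def onorm_id[unfolded id_def])

lemma frob_norm_mat_1: "(frob_norm (mat 1 :: real^'d^'d))\<^sup>2 = real CARD('d)"
proof -
  have "(\<Sum>j\<in>UNIV. ((mat 1 :: real^'d^'d) $ i $ j)\<^sup>2) = 1" for i :: 'd
    by (simp add: mat_def if_distrib[of "\<lambda>z. z\<^sup>2"] cong: if_cong)
  then show ?thesis by (simp add: frob_norm_def)
qed

lemma mat_norm_power2: "psd H \<Longrightarrow> (mat_norm H v)\<^sup>2 = v \<bullet> (H *v v)"
  by (simp add: psd_def mat_norm_def)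

lemma mat_norm_power2_le:
  "psd H \<Longrightarrow> (mat_norm H v)\<^sup>2 \<le> spec_norm H * (norm v)\<^sup>2"
  by (simp add: mat_norm_power2 inner_matrix_vector_le_spec_norm)

section \<open>Column lengths from the sketch inequality\<close>

lemma inner_gram_eq_sum_columns:
  fixes S :: "real^'l^'d"
  shows "u \<bullet> ((S ** transpose S) *v u) = (\<Sum>i\<in>UNIV. (u \<bullet> column i S)\<^sup>2)"
proof -
  have "u \<bullet> ((S ** transpose S) *v u) = (transpose S *v u) \<bullet> (transpose S *v u)"
    by (simp add: matrix_vector_mul_assoc[symmetric] dot_lmul_matrix[symmetric]
        transpose_matrix_vector)
  also have "\<dots> = (\<Sum>i\<in>UNIV. (u \<bullet> column i S)\<^sup>2)"
    by (simp add: inner_vec_def column_def transpose_def matrix_vector_mult_def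
        power2_eq_square mult_ac)
  finally show ?thesis .
qed

text \<open>For the identity both norms on the right of the sketch inequality are explicit, and the
  quadratic form of the error \<open>S S^T - I\<close> is at most its spectral norm times the
  squared length of \<open>u\<close>.\<close>

lemma sketch_ineq_imp_gram_le:
  fixes S :: "real^'l^'d"
  assumes "sketch_ineq \<gamma> k (mat 1) S"
  shows "u \<bullet> ((S ** transpose S) *v u) \<le> (1 + \<gamma> * (1 + real CARD('d) / k)) * (norm u)\<^sup>2"
proof -
  let ?E = "S ** transpose S - mat 1"
  have "spec_norm ?E \<le> \<gamma> * (1 + real CARD('d) / k)"
    using assms
    by (simp add: sketch_ineq_def spec_norm_mat_1 frob_norm_mat_1 transpose_mat)
  then have "u \<bullet> (?E *v u) \<le> \<gamma> * (1 + real CARD('d) / k) * (norm u)\<^sup>2"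
    by (meson inner_matrix_vector_le_spec_norm mult_right_mono order_trans zero_le_power2)
  then show ?thesis
    by (simp add: matrix_vector_mult_diff_rdistrib inner_diff_right power2_norm_eq_inner
        algebra_simps)
qed

text \<open>Testing the Gram bound at \<open>u = column j S\<close> suffices: the sum of squares
  contains the fourth power of \<open>norm u\<close>, the bound is a multiple of its square, and one
  square cancels.\<close>

lemma sketch_ineq_imp_column_le:
  fixes S :: "real^'l^'d"
  assumes "sketch_ineq \<gamma> k (mat 1) S" and "0 \<le> \<gamma>" and "0 \<le> k"
  shows "(norm (column j S))\<^sup>2 \<le> 1 + \<gamma> * (1 + real CARD('d) / k)"
proof -
  let ?b = "1 + \<gamma> * (1 + real CARD('d) / k)"
  let ?s = "column j S"
  have "(norm ?s)\<^sup>2 * (norm ?s)\<^sup>2 = (?s \<bullet> column j S)\<^sup>2"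
    by (simp add: power2_norm_eq_inner power2_eq_square[of "_ \<bullet> _"])
  also have "\<dots> \<le> (\<Sum>i\<in>UNIV. (?s \<bullet> column i S)\<^sup>2)"
    by (rule member_le_sum) auto
  also have "\<dots> = ?s \<bullet> ((S ** transpose S) *v ?s)"
    by (rule inner_gram_eq_sum_columns[symmetric])
  also have "\<dots> \<le> ?b * (norm ?s)\<^sup>2"
    by (rule sketch_ineq_imp_gram_le[OF assms(1)])
  finally have le: "(norm ?s)\<^sup>2 * (norm ?s)\<^sup>2 \<le> ?b * (norm ?s)\<^sup>2" .
  show ?thesis
  proof (cases "?s = 0")
    case True
    have "0 \<le> ?b" using assms(2,3) by simp
    with True show ?thesis by simp
  next
    case False
    then have "0 < (norm ?s)\<^sup>2" by simp
    then show ?thesis using le by (rule mult_right_le_imp_le[rotated])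
  qed
qed

section \<open>Deviations from the mean and the linearization error\<close>

text \<open>The mean minimises the sum of squared deviations: expanding around the mean
  \<open>m\<close>, the cross terms cancel and the surplus is \<open>n * (m - c)^2\<close>.\<close>

lemma sum_squared_deviation_le:
  fixes a :: "'i \<Rightarrow> real"
  assumes "finite I" and "I \<noteq> {}"
  shows "(\<Sum>j\<in>I. (a j - 1 / real (card I) * (\<Sum>i\<in>I. a i))\<^sup>2) \<le> (\<Sum>j\<in>I. (a j - c)\<^sup>2)"
proof -
  define n where "n = real (card I)"
  define m where "m = 1 / n * (\<Sum>i\<in>I. a i)"
  have n: "n > 0" using assms by (simp add: n_def card_gt_0_iff)
  have s: "(\<Sum>i\<in>I. a i) = n * m" using n by (simp add: m_def)
  have "(\<Sum>j\<in>I. (a j - c)\<^sup>2) = (\<Sum>j\<in>I. (a j - m)\<^sup>2 + 2 * (m - c) * (a j - m) + (m - c)\<^sup>2)"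
    by (intro sum.cong refl) (simp add: power2_eq_square algebra_simps)
  also have "\<dots> = (\<Sum>j\<in>I. (a j - m)\<^sup>2) + 2 * (m - c) * ((\<Sum>j\<in>I. a j) - n * m) + n * (m - c)\<^sup>2"
    by (simp add: sum.distrib sum_distrib_left[symmetric] sum_subtractf n_def)
  also have "\<dots> = (\<Sum>j\<in>I. (a j - m)\<^sup>2) + n * (m - c)\<^sup>2" by (simp add: s)
  finally show ?thesis using n by (simp add: m_def n_def)
qed

lemma power2_add_le: "((a::real) + b)\<^sup>2 \<le> 2 * a\<^sup>2 + 2 * b\<^sup>2"
  using zero_le_power2[of "a - b"] by (simp add: power2_eq_square algebra_simps)

text \<open>Trades the \<open>H\<close>-seminorm for the Euclidean norm at the cost of one factor
  \<open>spec_norm H\<close>. Squaring the radius condition brings in a second such factor, which is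
  why \<open>small\<close> contains the square of \<open>spec_norm H\<close>.\<close>

lemma L0L1_smooth_linear_approx:
  fixes f :: "real^'d \<Rightarrow> real"
  assumes "L0L1_smooth f H L0 L1" and "psd H" and "0 \<le> L0" and "0 \<le> L1"
    and v: "(norm v)\<^sup>2 \<le> r" and small: "(L1 * spec_norm H)\<^sup>2 * r \<le> 1"
  shows "\<bar>f (x + v) - f x - grad f x \<bullet> v\<bar>
           \<le> (L0 + L1 * norm (grad f x)) / 2 * (spec_norm H * r)"
proof -
  have m: "(mat_norm H v)\<^sup>2 \<le> spec_norm H * r"
    using mat_norm_power2_le[OF \<open>psd H\<close>, of v] mult_left_mono[OF v spec_norm_nonneg[of H]]
    by linarith
  have "(L1 * sqrt (spec_norm H) * mat_norm H v)\<^sup>2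
          = L1\<^sup>2 * spec_norm H * (mat_norm H v)\<^sup>2"
    by (simp add: power_mult_distrib spec_norm_nonneg)
  also have "\<dots> \<le> L1\<^sup>2 * spec_norm H * (spec_norm H * r)"
    by (intro mult_left_mono m) (simp add: spec_norm_nonneg)
  also have "\<dots> \<le> 1" using small by (simp add: power2_eq_square mult_ac)
  finally have "L1 * sqrt (spec_norm H) * mat_norm H v \<le> 1"
    using power2_le_imp_le[of "L1 * sqrt (spec_norm H) * mat_norm H v" 1] by simp
  then have "\<bar>f (x + v) - f x - grad f x \<bullet> v\<bar>
          \<le> (L0 + L1 * norm (grad f x)) / 2 * (mat_norm H v)\<^sup>2"
    using \<open>L0L1_smooth f H L0 L1\<close>[unfolded L0L1_smooth_def, rule_format, of "x + v" x] by simp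
  also have "\<dots> \<le> (L0 + L1 * norm (grad f x)) / 2 * (spec_norm H * r)"
    using assms(3,4) by (intro mult_left_mono m) simp
  finally show ?thesis .
qed

section \<open>The deterministic bound for a fixed sketch\<close>

lemma sigma_std_le:
  fixes f :: "real^'d \<Rightarrow> real" and S :: "real^'l^'d"
  assumes smooth: "L0L1_smooth f H L0 L1" "psd H" "0 \<le> L0" "0 \<le> L1"
    and "4 \<le> k" and "0 < \<alpha>"
    and ok: "smoothing_ok f L0 L1 (zeta1 H CARD('l) k) \<alpha> x"
    and sk: "sketch_ineq (1/4) k (mat 1) S" and ev: "event2 f k x S"
  shows "sigma_std f \<alpha> x S \<le> 13 * \<alpha> * norm (grad f x) / (2 * sqrt (real CARD('l) - 1))"
proof -
  define b where "b = 1 + 1/4 * (1 + real CARD('d) / k)"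
  define l where "l = real CARD('l)"
  define h where "h = spec_norm H"
  define G where "G = norm (grad f x)"
  define s where "s j = column j S" for j
  define c where "c = (L0 + L1 * G) / 2 * (h * (\<alpha>\<^sup>2 * b))"
  have b: "1 \<le> b" using \<open>4 \<le> k\<close> by (simp add: b_def)
  have l: "1 \<le> l" using zero_less_card_finite[where 'a='l] unfolding l_def by linarith
  have h: "0 \<le> h" unfolding h_def by (rule spec_norm_nonneg)
  \<comment> \<open>The bracket in \<open>zeta1\<close> is \<open>b * l\<close>, so both
    restrictions on \<alpha> concern the single quantity
    \<open>\<alpha> * h * b * l\<close>.\<close>
  have "zeta1 H CARD('l) k = (h * (b * l))\<^sup>2"
    using \<open>4 \<le> k\<close>
    by (simp add: zeta1_def h_def b_def l_def power_mult_distrib[symmetric] field_simps)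
  then have ok1: "2 * (L1 * (\<alpha> * h * b * l))\<^sup>2 \<le> 1"
    and ok0: "8 * (L0 * (\<alpha> * h * b * l))\<^sup>2 \<le> 3 * G\<^sup>2"
    using ok by (simp_all add: smoothing_ok_def G_def power_mult_distrib mult_ac)
  have step: "(norm (\<alpha> *\<^sub>R s j))\<^sup>2 \<le> \<alpha>\<^sup>2 * b" for j
    using sketch_ineq_imp_column_le[OF sk, of j] \<open>4 \<le> k\<close>
    by (simp add: s_def b_def power_mult_distrib mult_left_mono)
  \<comment> \<open>The radius condition involves only \<open>b\<close>, while \<open>ok1\<close>
    controls \<open>(b * l)^2\<close>; as \<open>b\<close> and \<open>l\<close> are at least 1, the
    latter dominates.\<close>
  have "b \<le> (b * l)\<^sup>2"
  proof -
    have "1 \<le> b * l\<^sup>2"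
      using mult_mono[OF b one_le_power[OF l, of 2]] b by simp
    then have "b * 1 \<le> b * (b * l\<^sup>2)"
      using b by (intro mult_left_mono) simp_all
    then show ?thesis by (simp add: power2_eq_square mult_ac)
  qed
  then have "(L1 * h)\<^sup>2 * (\<alpha>\<^sup>2 * b) \<le> (L1 * h)\<^sup>2 * (\<alpha>\<^sup>2 * (b * l)\<^sup>2)"
    by (intro mult_left_mono) simp_all
  also have "\<dots> \<le> 1"
    using ok1 zero_le_power2[of "L1 * (\<alpha> * h * b * l)"]
    by (simp add: power_mult_distrib mult_ac)
  finally have small: "(L1 * h)\<^sup>2 * (\<alpha>\<^sup>2 * b) \<le> 1" .
  define r where "r j = f (x + \<alpha> *\<^sub>R s j) - f x - \<alpha> * (grad f x \<bullet> s j)" for j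
  have r: "(r j)\<^sup>2 \<le> c\<^sup>2" for j
  proof -
    have "\<bar>r j\<bar> \<le> c"
      using L0L1_smooth_linear_approx[OF smooth step[of j] small[unfolded h_def], of x]
      by (simp add: r_def c_def G_def h_def)
    then show ?thesis by (simp add: abs_le_square_iff[symmetric])
  qed
  have "(\<Sum>j\<in>UNIV. (r j)\<^sup>2) \<le> l * c\<^sup>2"
    using sum_bounded_above[of UNIV "\<lambda>j. (r j)\<^sup>2" "c\<^sup>2"] r by (simp add: l_def)
  \<comment> \<open>The extra factor \<open>l\<close> is given away so that \<open>l * c\<close>
    contains exactly \<open>\<alpha> * h * b * l\<close>.\<close>
  also have "\<dots> \<le> l\<^sup>2 * c\<^sup>2"
    using l by (intro mult_right_mono) (simp_all add: power2_eq_square)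
  also have "\<dots> = \<alpha>\<^sup>2 / 4 * (L0 * (\<alpha> * h * b * l) + G * (L1 * (\<alpha> * h * b * l)))\<^sup>2"
    by (simp add: c_def power2_eq_square field_simps)
  \<comment> \<open>After splitting the square, \<open>7/4 = 2 * 3/8 + 2 * 1/2\<close>, from
    \<open>ok0\<close> and \<open>ok1\<close> respectively.\<close>
  also have "\<dots> \<le> \<alpha>\<^sup>2 / 4 * (7/4 * G\<^sup>2)"
  proof (rule mult_left_mono)
    have "G\<^sup>2 * (2 * (L1 * (\<alpha> * h * b * l))\<^sup>2) \<le> G\<^sup>2 * 1"
      by (intro mult_left_mono ok1) simp
    then show "(L0 * (\<alpha> * h * b * l) + G * (L1 * (\<alpha> * h * b * l)))\<^sup>2 \<le> 7/4 * G\<^sup>2"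
      using power2_add_le[of "L0 * (\<alpha> * h * b * l)" "G * (L1 * (\<alpha> * h * b * l))"] ok0
      by (simp add: power_mult_distrib[of G])
  qed simp
  finally have sum_r: "(\<Sum>j\<in>UNIV. (r j)\<^sup>2) \<le> \<alpha>\<^sup>2 / 4 * (7/4 * G\<^sup>2)" .
  have "(\<Sum>j\<in>UNIV. (grad f x \<bullet> s j)\<^sup>2) \<le> (5/4 + 1/k) * G\<^sup>2"
    using ev by (simp add: event2_def inner_gram_eq_sum_columns s_def G_def)
  also have "\<dots> \<le> 3/2 * G\<^sup>2"
    using \<open>4 \<le> k\<close> by (intro mult_right_mono) (simp_all add: field_simps)
  finally have sum_g: "(\<Sum>j\<in>UNIV. (grad f x \<bullet> s j)\<^sup>2) \<le> 3/2 * G\<^sup>2" .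
  have "(\<Sum>j\<in>UNIV. (f (x + \<alpha> *\<^sub>R s j) - 1 / l * (\<Sum>i\<in>UNIV. f (x + \<alpha> *\<^sub>R s i)))\<^sup>2)
          \<le> (\<Sum>j\<in>UNIV. (f (x + \<alpha> *\<^sub>R s j) - f x)\<^sup>2)"
    unfolding l_def by (rule sum_squared_deviation_le) auto
  also have "\<dots> \<le> (\<Sum>j\<in>UNIV. 2 * \<alpha>\<^sup>2 * (grad f x \<bullet> s j)\<^sup>2 + 2 * (r j)\<^sup>2)"
  proof (rule sum_mono)
    fix j
    show "(f (x + \<alpha> *\<^sub>R s j) - f x)\<^sup>2 \<le> 2 * \<alpha>\<^sup>2 * (grad f x \<bullet> s j)\<^sup>2 + 2 * (r j)\<^sup>2"
      using power2_add_le[of "\<alpha> * (grad f x \<bullet> s j)" "r j"]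
      by (simp add: r_def power_mult_distrib)
  qed
  also have "\<dots> = 2 * \<alpha>\<^sup>2 * (\<Sum>j\<in>UNIV. (grad f x \<bullet> s j)\<^sup>2) + 2 * (\<Sum>j\<in>UNIV. (r j)\<^sup>2)"
    by (simp add: sum.distrib sum_distrib_left)
  also have "\<dots> \<le> 2 * \<alpha>\<^sup>2 * (3/2 * G\<^sup>2) + 2 * (\<alpha>\<^sup>2 / 4 * (7/4 * G\<^sup>2))"
    by (intro add_mono mult_left_mono sum_g sum_r) simp_all
  also have "\<dots> = 31/8 * (\<alpha> * G)\<^sup>2"
    by (simp add: power_mult_distrib)
  \<comment> \<open>The target constant is \<open>(13/2)^2 = 169/4\<close>, which leaves ample
    slack.\<close>
  also have "\<dots> \<le> 169/4 * (\<alpha> * G)\<^sup>2"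
    by (intro mult_right_mono) simp_all
  also have "\<dots> = (13 / 2 * \<alpha> * G)\<^sup>2"
    by (simp add: power2_eq_square)
  \<comment> \<open>The case \<open>l = 1\<close> is included: division by zero gives 0, so both
    sides vanish.\<close>
  finally have "1 / (l - 1) *
      (\<Sum>j\<in>UNIV. (f (x + \<alpha> *\<^sub>R s j) - 1 / l * (\<Sum>i\<in>UNIV. f (x + \<alpha> *\<^sub>R s i)))\<^sup>2)
      \<le> 1 / (l - 1) * (13 / 2 * \<alpha> * G)\<^sup>2"
    using l by (intro mult_left_mono) simp_all
  then have "sigma_std f \<alpha> x S \<le> sqrt (1 / (l - 1) * (13 / 2 * \<alpha> * G)\<^sup>2)"
    unfolding sigma_std_def s_def l_def by (rule real_sqrt_le_mono)
  also have "\<dots> = 13 / 2 * \<alpha> * G / sqrt (l - 1)"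
    using \<open>0 < \<alpha>\<close> by (simp add: real_sqrt_mult real_sqrt_divide G_def)
  finally show ?thesis by (simp add: l_def G_def)
qed

section \<open>Measurability and the probabilistic statement\<close>

lemma continuous_on_column: "continuous_on A (\<lambda>S :: real^'l^'d. column j S)"
  unfolding column_def by (intro continuous_intros)

text \<open>Continuity of \<open>f\<close> makes the deviation continuous in the entries of the
  sketch. Measurability matters because \<open>measure\<close> is 0 on non-measurable sets, where a
  lower bound would fail.\<close>

lemma measurable_sigma_std:
  fixes f :: "real^'d \<Rightarrow> real" and S :: "'w \<Rightarrow> real^'l^'d"
  assumes f: "continuous_on UNIV f" and S: "S \<in> borel_measurable M"
  shows "(\<lambda>\<omega>. sigma_std f \<alpha> x (S \<omega>)) \<in> borel_measurable M"
proof -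
  have "continuous_on UNIV (\<lambda>S :: real^'l^'d. f (x + \<alpha> *\<^sub>R column j S))" for j
    by (intro continuous_on_compose2[OF f] continuous_intros continuous_on_column) auto
  then have "continuous_on UNIV (\<lambda>S :: real^'l^'d. sigma_std f \<alpha> x S)"
    unfolding sigma_std_def by (intro continuous_intros)
  then show ?thesis
    by (rule borel_measurable_continuous_on[OF _ S])
qed

lemma measurable_event2:
  fixes f :: "real^'d \<Rightarrow> real" and S :: "'w \<Rightarrow> real^'l^'d"
  assumes S: "S \<in> borel_measurable M"
  shows "{\<omega> \<in> space M. event2 f k x (S \<omega>)} \<in> sets M"
proof -
  have "continuous_on UNIV (\<lambda>S :: real^'l^'d. grad f x \<bullet> ((S ** transpose S) *v grad f x))"
    unfolding inner_gram_eq_sum_columns by (intro continuous_intros continuous_on_column)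
  then have [measurable]:
    "(\<lambda>\<omega>. grad f x \<bullet> ((S \<omega> ** transpose (S \<omega>)) *v grad f x)) \<in> borel_measurable M"
    by (rule borel_measurable_continuous_on[OF _ S])
  show ?thesis unfolding event2_def by measurable
qed

text \<open>\<open>event2\<close> constrains only the components of the columns along the gradient;
  their lengths come from the sketch inequality for \<open>mat 1\<close>, which may fail with
  probability up to \<delta>. Hence a pointwise claim under both conditions, and a probability bound
  for the implication from \<open>event2\<close>.\<close>

theorem lemma10:
  fixes M :: "'w measure"
    and f :: "real^'d \<Rightarrow> real"
    and H :: "real^'d^'d"
    and S :: "'w \<Rightarrow> real^'l^'d"
    and x :: "real^'d"
    and L0 L1 k \<delta> \<alpha> :: real
  assumes "prob_space M"
    and "\<forall>y. f differentiable (at y)"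
    and "psd H" and "0 \<le> L0" and "0 \<le> L1"
    and "L0L1_smooth f H L0 L1"
    and "4 \<le> k" and "0 < \<delta>" and "\<delta> < 1"
    and "oblivious_sketch M (1/4) k \<delta> S"
    and "0 < \<alpha>"
    and "smoothing_ok f L0 L1 (zeta1 H CARD('l) k) \<alpha> x"
  shows "(\<forall>\<omega>\<in>space M. sketch_ineq (1/4) k (mat 1) (S \<omega>) \<and> event2 f k x (S \<omega>) \<longrightarrow>
            sigma_std f \<alpha> x (S \<omega>) \<le> 13 * \<alpha> * norm (grad f x) / (2 * sqrt (real CARD('l) - 1)))
       \<and> measure M {\<omega> \<in> space M. event2 f k x (S \<omega>) \<longrightarrow>
            sigma_std f \<alpha> x (S \<omega>) \<le> 13 * \<alpha> * norm (grad f x) / (2 * sqrt (real CARD('l) - 1))}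
          \<ge> 1 - \<delta>"
proof -
  let ?B = "13 * \<alpha> * norm (grad f x) / (2 * sqrt (real CARD('l) - 1))"
  let ?good = "{\<omega> \<in> space M. event2 f k x (S \<omega>) \<longrightarrow> sigma_std f \<alpha> x (S \<omega>) \<le> ?B}"
  interpret prob_space M by fact
  have bound: "sigma_std f \<alpha> x (S \<omega>) \<le> ?B"
    if "sketch_ineq (1/4) k (mat 1) (S \<omega>)" "event2 f k x (S \<omega>)" for \<omega>
    using sigma_std_le that assms by blast
  have S: "S \<in> borel_measurable M"
    and prob: "1 - \<delta> \<le> prob {\<omega> \<in> space M. sketch_ineq (1/4) k (mat 1) (S \<omega>)}"
    using \<open>oblivious_sketch M (1/4) k \<delta> S\<close> by (auto simp: oblivious_sketch_def)
  have "continuous_on UNIV f"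
    using \<open>\<forall>y. f differentiable (at y)\<close>
    by (simp add: continuous_on_eq_continuous_at differentiable_imp_continuous_within)
  note [measurable] = measurable_sigma_std[OF this S] measurable_event2[OF S]
  have "?good \<in> sets M" by measurable
  \<comment> \<open>Wherever the sketch inequality for the identity holds, \<open>bound\<close>
    gives the implication, so monotonicity transfers the lower bound
    \<open>1 - \<delta>\<close>.\<close>
  then have "prob {\<omega> \<in> space M. sketch_ineq (1/4) k (mat 1) (S \<omega>)} \<le> prob ?good"
    using bound by (intro finite_measure_mono) auto
  with prob bound show ?thesis by auto
qed

end
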